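(* All of the $51_{65}$-networks $(N,f_1)$, $(N,f_2)$, $(N,f_3)$, and $(N,f_4)$ are consistent, but none is satisfiable in any representation of $51_{65}$.
   Context: A relation algebra is an algebra $\mathbf{A}=(A;\cup,\bar{\ },0,1,\mathrm{Id},\breve{\ },\circ)$ such that, with $x\cap y:=\overline{(\bar x\cup\bar y)}$, the structure $(A;\cup,\cap,\bar{\ },0,1)$ is a Boolean algebra, $\circ$ is associative, and for all $a,b,c\in A$: $(a\cup b)\circ c=(a\circ c)\cup(b\circ c)$; $a\circ\mathrm{Id}=a$; $\breve{\breve a}=a$; $(a\cup b)\breve{\ }=\breve a\cup\breve b$; $(a\circ b)\breve{\ }=\breve b\circ\breve a$; $\bar b\cup(\breve a\circ\overline{(a\circ b)})=\bar b$. Write $a\le b$ if $a\cap b=a$. An atom is a minimal element of $A\setminus\{0\}$ with respect to $\le$. In a finite relation algebra, $\circ$ and $\breve{\ }$ are determined by their values on atoms. $51_{65}$ is the finite relation algebra with exactly four atoms $\mathrm{Id},a,b,c$, all satisfying $\breve x=x$, where $\mathrm{Id}\circ x=x\circ\mathrm{Id}=x$, where for $x,y\in\{a,b,c\}$ we have $\mathrm{Id}\le x\circ y$ iff $x=y$, and where for $x,y,z\in\{a,b,c\}$ we have $z\le x\circ y$ iff $(x,y,z)$ is neither $(a,a,a)$, nor $(c,c,c)$, nor a permutation of $(a,b,b)$ or of $(c,b,b)$. A representation of $\mathbf{A}$ is a relational structure $\mathfrak{B}$ with domain $B$ and a binary relation $a^{\mathfrak{B}}\subseteq B^2$ for each $a\in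 A$ such that for all $a,b\in A$: $0^{\mathfrak{B}}=\varnothing$; $1^{\mathfrak{B}}=\bigcup_{a\in A}a^{\mathfrak{B}}$; $\mathrm{Id}^{\mathfrak{B}}=\{(u,u)\mid u\in B\}$; $(\bar a)^{\mathfrak{B}}=1^{\mathfrak{B}}\setminus a^{\mathfrak{B}}$; $(\breve a)^{\mathfrak{B}}=\{(u,v)\mid(v,u)\in a^{\mathfrak{B}}\}$; $(a\cup b)^{\mathfrak{B}}=a^{\mathfrak{B}}\cup b^{\mathfrak{B}}$; $(a\circ b)^{\mathfrak{B}}=a^{\mathfrak{B}}\circ b^{\mathfrak{B}}$ (the usual composition of binary relations). An $\mathbf{A}$-network $(V,f)$ is a finite set $V$ together with a function $f\colon V^2\to A$. It is atomic if every $f(x,y)$ is an atom, and consistent if $f(x,x)\le\mathrm{Id}$ and $f(x,y)\le f(x,z)\circ f(z,y)$ for all $x,y,z\in V$. It is satisfiable in $\mathfrak{B}$ if there is $s\colon V\to B$ with $(s(x),s(y))\in f(x,y)^{\mathfrak{B}}$ for all $x,y\in V$. Let $N=\{0,1,2,3\}$ and define four atomic $51_{65}$-networks on $N$ (all symmetric, with $f_k(i,i)=\mathrm{Id}$) by: $f_1(0,1)=f_1(1,2)=f_1(2,3)=f_1(3,0)=a$ and $f_1(0,2)=f_1(1,3)=c$; $f_2(0,1)=f_2(1,2)=f_2(2,3)=f_2(3,0)=c$ and $f_2(0,2)=f_2(1,3)=a$; $f_3(0,1)=f_3(1,2)=f_3(2,3)=a$ and $f_3(0,2)=f_3(0,3)=f_3(1,3)=c$;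 $f_4(0,1)=f_4(2,3)=b$, $f_4(0,2)=f_4(1,3)=a$, $f_4(0,3)=f_4(1,2)=c$. *)

theory Defs
  imports Main
begin

(* The Boolean part (sup, -, bot, top) is the library class; the carrier is the whole type. *)
locale relation_algebra =
  fixes comp :: "'a::boolean_algebra \<Rightarrow> 'a \<Rightarrow> 'a"  (infixr "\<odot>" 75)
    and conv :: "'a \<Rightarrow> 'a"
    and ident :: 'a
  assumes comp_assoc: "(x \<odot> y) \<odot> z = x \<odot> (y \<odot> z)"
    and comp_sup_left: "sup x y \<odot> z = sup (x \<odot> z) (y \<odot> z)"
    and comp_ident: "x \<odot> ident = x"
    and conv_conv: "conv (conv x) = x"
    and conv_sup: "conv (sup x y) = sup (conv x) (conv y)"
    and conv_comp: "conv (x \<odot> y) = conv y \<odot> conv x"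
    and tarski: "sup (- y) (conv x \<odot> (- (x \<odot> y))) = - y"
begin

definition is_atom :: "'a \<Rightarrow> bool" where
  "is_atom x \<longleftrightarrow> x \<noteq> bot \<and> (\<forall>y. y \<noteq> bot \<and> y \<le> x \<longrightarrow> y = x)"

text \<open>The domain \<^term>\<open>B\<close> may be any subset of the ambient type, and the top element denotes
  the union of all the relations, which need not be \<^term>\<open>B \<times> B\<close>.\<close>

definition representation :: "'b set \<Rightarrow> ('a \<Rightarrow> ('b \<times> 'b) set) \<Rightarrow> bool" where
  "representation B R \<longleftrightarrow>
     (\<forall>x. R x \<subseteq> B \<times> B) \<and>
     R bot = {} \<and>
     R top = (\<Union>x. R x) \<and>
     R ident = {(u, u) | u. u \<in> B} \<and>
     (\<forall>x. R (- x) = R top - R x) \<and>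
     (\<forall>x. R (conv x) = {(u, v). (v, u) \<in> R x}) \<and>
     (\<forall>x y. R (sup x y) = R x \<union> R y) \<and>
     (\<forall>x y. R (x \<odot> y) = R x O R y)"

text \<open>Only the values of a labelling \<^term>\<open>f\<close> on \<^term>\<open>V \<times> V\<close> matter in the following notions.\<close>

definition network :: "'v set \<Rightarrow> ('v \<Rightarrow> 'v \<Rightarrow> 'a) \<Rightarrow> bool" where
  "network V f \<longleftrightarrow> finite V"

definition atomic :: "'v set \<Rightarrow> ('v \<Rightarrow> 'v \<Rightarrow> 'a) \<Rightarrow> bool" where
  "atomic V f \<longleftrightarrow> network V f \<and> (\<forall>x\<in>V. \<forall>y\<in>V. is_atom (f x y))"

definition consistent :: "'v set \<Rightarrow> ('v \<Rightarrow> 'v \<Rightarrow> 'a) \<Rightarrow> bool" where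
  "consistent V f \<longleftrightarrow> network V f \<and>
     (\<forall>x\<in>V. f x x \<le> ident) \<and>
     (\<forall>x\<in>V. \<forall>y\<in>V. \<forall>z\<in>V. f x y \<le> f x z \<odot> f z y)"

definition satisfiable ::
    "'v set \<Rightarrow> ('v \<Rightarrow> 'v \<Rightarrow> 'a) \<Rightarrow> 'b set \<Rightarrow> ('a \<Rightarrow> ('b \<times> 'b) set) \<Rightarrow> bool" where
  "satisfiable V f B R \<longleftrightarrow>
     (\<exists>s. (\<forall>x\<in>V. s x \<in> B) \<and> (\<forall>x\<in>V. \<forall>y\<in>V. (s x, s y) \<in> R (f x y)))"

end

text \<open>The algebra \<open>51\<^sub>6\<^sub>5\<close> is realised as the algebra of all sets of its four atoms, an atom
  \<open>x\<close> being the singleton \<open>{x}\<close>.\<close>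

datatype atom51 = At_Id | At_a | At_b | At_c

abbreviation Id51 :: "atom51 set" where "Id51 \<equiv> {At_Id}"
abbreviation a51 :: "atom51 set" where "a51 \<equiv> {At_a}"
abbreviation b51 :: "atom51 set" where "b51 \<equiv> {At_b}"
abbreviation c51 :: "atom51 set" where "c51 \<equiv> {At_c}"

definition forbidden51 :: "(atom51 \<times> atom51 \<times> atom51) set" where
  "forbidden51 =
     {(At_a, At_a, At_a), (At_c, At_c, At_c),
      (At_a, At_b, At_b), (At_b, At_a, At_b), (At_b, At_b, At_a),
      (At_c, At_b, At_b), (At_b, At_c, At_b), (At_b, At_b, At_c)}"

text \<open>\<open>below51 x y z\<close> says that the atom \<open>z\<close> lies below the composition of \<open>x\<close> and \<open>y\<close>.\<close>

definition below51 :: "atom51 \<Rightarrow> atom51 \<Rightarrow> atom51 \<Rightarrow> bool" where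
  "below51 x y z \<longleftrightarrow>
     (if x = At_Id then z = y
      else if y = At_Id then z = x
      else if z = At_Id then x = y
      else (x, y, z) \<notin> forbidden51)"

definition comp51 :: "atom51 set \<Rightarrow> atom51 set \<Rightarrow> atom51 set" where
  "comp51 X Y = {z. \<exists>x\<in>X. \<exists>y\<in>Y. below51 x y z}"

text \<open>The converse fixes every atom and is additive, hence it is the identity.\<close>

definition conv51 :: "atom51 set \<Rightarrow> atom51 set" where
  "conv51 X = X"

lemma ex_atom51: "(\<exists>x. P x) \<longleftrightarrow> P At_Id \<or> P At_a \<or> P At_b \<or> P At_c"
  by (metis atom51.exhaust)

lemma below51_assoc:
  "(\<exists>u. below51 x y u \<and> below51 u z w) \<longleftrightarrow> (\<exists>v. below51 y z v \<and> below51 x v w)"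
  unfolding ex_atom51
  by (cases x; cases y; cases z; cases w; simp add: below51_def forbidden51_def)

lemma below51_commute: "below51 x y z \<longleftrightarrow> below51 y x z"
  by (cases x; cases y; cases z; simp add: below51_def forbidden51_def)

lemma below51_rotate: "below51 x y z \<longleftrightarrow> below51 x z y"
  by (cases x; cases y; cases z; simp add: below51_def forbidden51_def)

global_interpretation ra51: relation_algebra comp51 conv51 Id51
proof
  fix x y z :: "atom51 set"
  show "comp51 (comp51 x y) z = comp51 x (comp51 y z)"
  proof (rule set_eqI)
    fix w
    have "w \<in> comp51 (comp51 x y) z \<longleftrightarrow>
        (\<exists>p\<in>x. \<exists>q\<in>y. \<exists>r\<in>z. \<exists>u. below51 p q u \<and> below51 u r w)"
      unfolding comp51_def by blast
    also have "\<dots> \<longleftrightarrow> (\<exists>p\<in>x. \<exists>q\<in>y. \<exists>r\<in>z. \<exists>v. below51 q r v \<and> below51 p v w)"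
      by (simp only: below51_assoc)
    also have "\<dots> \<longleftrightarrow> w \<in> comp51 x (comp51 y z)"
      unfolding comp51_def by blast
    finally show "w \<in> comp51 (comp51 x y) z \<longleftrightarrow> w \<in> comp51 x (comp51 y z)" .
  qed
  show "comp51 (sup x y) z = sup (comp51 x z) (comp51 y z)"
    unfolding comp51_def by blast
  show "comp51 x Id51 = x"
    unfolding comp51_def by (auto simp: below51_def split: if_splits)
  show "conv51 (conv51 x) = x"
    by (simp add: conv51_def)
  show "conv51 (sup x y) = sup (conv51 x) (conv51 y)"
    by (simp add: conv51_def)
  show "conv51 (comp51 x y) = comp51 (conv51 y) (conv51 x)"
    unfolding conv51_def comp51_def using below51_commute by blast
  show "sup (- y) (comp51 (conv51 x) (- comp51 x y)) = - y"
    unfolding conv51_def comp51_def using below51_rotate by blast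
qed

lemma atoms51: "{X. ra51.is_atom X} = {Id51, a51, b51, c51}"
proof (intro set_eqI iffI)
  fix X assume "X \<in> {X. ra51.is_atom X}"
  then have at: "X \<noteq> {}" "\<And>Y. Y \<noteq> {} \<Longrightarrow> Y \<subseteq> X \<Longrightarrow> Y = X"
    by (auto simp: ra51.is_atom_def)
  then obtain x where "x \<in> X" by blast
  then have "X = {x}" using at(2)[of "{x}"] by simp
  then show "X \<in> {Id51, a51, b51, c51}" by (cases x) auto
next
  fix X assume "X \<in> {Id51, a51, b51, c51}"
  then show "X \<in> {X. ra51.is_atom X}"
    by (auto simp: ra51.is_atom_def subset_singleton_iff)
qed

definition N51 :: "nat set" where
  "N51 = {0, 1, 2, 3}"

text \<open>Two-element sets \<open>{i, j}\<close> serve as unordered pairs, which makes the labellings symmetric;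
  in each case, the final \<open>c51\<close> is the label of all remaining pairs.\<close>

definition f1 :: "nat \<Rightarrow> nat \<Rightarrow> atom51 set" where
  "f1 i j =
     (if i = j then Id51
      else if {i, j} \<in> {{0, 1}, {1, 2}, {2, 3}, {3, 0}} then a51
      else c51)"

definition f2 :: "nat \<Rightarrow> nat \<Rightarrow> atom51 set" where
  "f2 i j =
     (if i = j then Id51
      else if {i, j} \<in> {{0, 2}, {1, 3}} then a51
      else c51)"

definition f3 :: "nat \<Rightarrow> nat \<Rightarrow> atom51 set" where
  "f3 i j =
     (if i = j then Id51
      else if {i, j} \<in> {{0, 1}, {1, 2}, {2, 3}} then a51
      else c51)"

definition f4 :: "nat \<Rightarrow> nat \<Rightarrow> atom51 set" where
  "f4 i j =
     (if i = j then Id51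
      else if {i, j} \<in> {{0, 1}, {2, 3}} then b51
      else if {i, j} \<in> {{0, 2}, {1, 3}} then a51
      else c51)"

lemma atomic_f:
  "ra51.atomic N51 f1" "ra51.atomic N51 f2" "ra51.atomic N51 f3" "ra51.atomic N51 f4"
proof -
  have "ra51.is_atom X" if "X \<in> {Id51, a51, b51, c51}" for X
    using that atoms51 by blast
  then show "ra51.atomic N51 f1" "ra51.atomic N51 f2" "ra51.atomic N51 f3" "ra51.atomic N51 f4"
    by (auto simp: ra51.atomic_def ra51.network_def N51_def f1_def f2_def f3_def f4_def)
qed

end

theory Submission imports Defs
begin

text \<open>In a representation, \<open>Id \<union> b\<close> is an equivalence relation, and pairs from different classes
  are labelled \<open>a\<close> or \<open>c\<close> without monochromatic triangles across three classes. Say that \<open>x\<close>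
  separates \<open>p\<close> over \<open>q\<close> if \<open>x p\<close> is labelled \<open>a\<close> and \<open>x q\<close> is labelled \<open>c\<close>. All points separating
  \<open>p\<close> over \<open>q\<close> lie in one class, because they cannot be joined by \<open>a\<close> or by \<open>c\<close>. Unsatisfiability
  of \<open>f\<^sub>4\<close> means that a point separating \<open>p\<close> over \<open>q\<close> and a point separating \<open>q\<close> over \<open>p\<close> lie in
  different classes. So every class separates pairs of points of a fixed class as a preorder
  would, and every pair of \<open>b\<close>-related points is separated by exactly two classes, in opposite
  directions. As every outer point splits a class into two parts having at least two elements each,
  this leaves room for only two outer classes. The other networks need three of them.\<close>

text \<open>The label relations are axiomatised apart from the algebra so that exchanging
  \<open>a\<close> and \<open>c\<close> becomes a reinterpretation of the locale. Two points may
  carry no label at all, since the top element need not denote the full square.\<close>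

locale representation51 =
  fixes a b c :: "'b \<Rightarrow> 'b \<Rightarrow> bool"
  assumes a_sym: "a x y \<Longrightarrow> a y x"
    and b_sym: "b x y \<Longrightarrow> b y x"
    and c_sym: "c x y \<Longrightarrow> c y x"
    and a_irrefl: "\<not> a x x"
    and b_irrefl: "\<not> b x x"
    and c_irrefl: "\<not> c x x"
    and not_ab: "\<not> (a x y \<and> b x y)"
    and not_ac: "\<not> (a x y \<and> c x y)"
    and not_bc: "\<not> (b x y \<and> c x y)"
    and comp_aa: "a x y \<Longrightarrow> a y z \<Longrightarrow> x = z \<or> b x z \<or> c x z"
    and comp_cc: "c x y \<Longrightarrow> c y z \<Longrightarrow> x = z \<or> b x z \<or> a x z"
    and comp_bb: "b x y \<Longrightarrow> b y z \<Longrightarrow> x = z \<or> b x z"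
    and comp_ab: "a x y \<Longrightarrow> b y z \<Longrightarrow> a x z \<or> c x z"
    and comp_cb: "c x y \<Longrightarrow> b y z \<Longrightarrow> a x z \<or> c x z"
    and b_le_ac: "b x y \<Longrightarrow> \<exists>z. a x z \<and> c z y"
    and a_le_cc: "a x y \<Longrightarrow> \<exists>z. c x z \<and> c z y"
    and c_le_aa: "c x y \<Longrightarrow> \<exists>z. a x z \<and> a z y"
    and a_le_ab: "a x y \<Longrightarrow> \<exists>z. a x z \<and> b z y"
    and a_le_cb: "a x y \<Longrightarrow> \<exists>z. c x z \<and> b z y"
    and c_le_ab: "c x y \<Longrightarrow> \<exists>z. a x z \<and> b z y"
    and c_le_cb: "c x y \<Longrightarrow> \<exists>z. c x z \<and> b z y"
begin

section \<open>Classes of the equivalence \<open>E\<close> and unsatisfiability of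
  \<open>f4\<close>\<close>

definition E :: "'b \<Rightarrow> 'b \<Rightarrow> bool" where
  "E x y \<longleftrightarrow> x = y \<or> b x y"

definition sep :: "'b \<Rightarrow> 'b \<Rightarrow> 'b \<Rightarrow> bool" where
  "sep x p q \<longleftrightarrow> a x p \<and> c x q"

text \<open>The forbidden triples are invariant under exchanging \<open>a\<close> and
  \<open>c\<close>. Only \<open>b_le_ac\<close> changes direction, which the symmetry of the labels
  repairs.\<close>

lemma swap: "representation51 c b a"
proof (unfold_locales, goal_cases)
  case (7 x y)
  show ?case using not_bc[of x y] by blast
next
  case (8 x y)
  show ?case using not_ac[of x y] by blast
next
  case (9 x y)
  show ?case using not_ab[of x y] by blast
next
  case (13 x y z)
  then show ?case using comp_cb[of x y z] by blast
next
  case (14 x y z)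
  then show ?case using comp_ab[of x y z] by blast
next
  case (15 x y)
  then show ?case using b_le_ac[OF b_sym] a_sym c_sym by blast
qed (fact a_sym b_sym c_sym a_irrefl b_irrefl c_irrefl comp_aa comp_cc comp_bb
    a_le_cc c_le_aa a_le_ab a_le_cb c_le_ab c_le_cb)+

lemma E_refl: "E x x"
  by (simp add: E_def)

lemma E_sym: "E x y \<Longrightarrow> E y x"
  unfolding E_def using b_sym by blast

lemma E_trans: "E x y \<Longrightarrow> E y z \<Longrightarrow> E x z"
  unfolding E_def using comp_bb by blast

lemma not_E: "a x y \<or> c x y \<Longrightarrow> \<not> E x y"
  unfolding E_def using a_irrefl c_irrefl not_ab not_bc by blast

lemma ac_class: "a x p \<or> c x p \<Longrightarrow> E p q \<Longrightarrow> a x q \<or> c x q"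
  unfolding E_def using comp_ab comp_cb by blast

lemma f4_unsat:
  assumes "b p q" "b x y" "a x p" "a y q" "c x q" "c y p"
  shows False
proof -
  \<comment> \<open>Avoiding \<open>c\<close>-triangles and \<open>a\<close>-triangles forces the
    labels of \<open>z q\<close> and \<open>z y\<close> in turn, until \<open>z\<close>,
    \<open>y\<close>, \<open>p\<close> form a \<open>c\<close>-triangle.\<close>
  obtain z where z: "c x z" "c z p" using a_le_cc[OF \<open>a x p\<close>] by blast
  have "c z x" by (rule c_sym[OF z(1)])
  then have zy: "a z y \<or> c z y" using comp_cb \<open>b x y\<close> by blast
  have zq: "a z q \<or> c z q" using comp_cb z(2) \<open>b p q\<close> by blast
  have "\<not> c z q"
    using comp_cc[OF \<open>c z x\<close> \<open>c x q\<close>] c_irrefl not_ac not_bc by blast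
  then have "a z q" using zq by blast
  then have "\<not> a z y"
    using comp_aa[OF _ a_sym[OF \<open>a y q\<close>]] a_irrefl not_ac not_ab by blast
  then have "c z y" using zy by blast
  then show False
    using comp_cc[OF _ \<open>c y p\<close>] z(2) c_irrefl not_ac not_bc by blast
qed

section \<open>Separation of points within a class\<close>

lemma sep_same:
  assumes "sep x p q" "sep y p q"
  shows "E x y"
  using assms comp_aa[of x p y] comp_cc[of x q y] a_sym c_sym not_ac
  unfolding sep_def E_def by blast

lemma sep_opposite:
  assumes "E p q" "sep x p q" "sep y q p"
  shows "\<not> E x y"
  using assms f4_unsat[of p q x y] not_ac unfolding sep_def E_def by blast

lemma sep_neq: "sep x p q \<Longrightarrow> p \<noteq> q"
  unfolding sep_def using not_ac by blast

lemma sep_exists: "E p q \<Longrightarrow> p \<noteq> q \<Longrightarrow> \<exists>x. sep x p q"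
  unfolding sep_def E_def using b_le_ac a_sym by blast

lemma sep_cases:
  assumes "sep w p q" "E p r"
  shows "sep w p r \<or> sep w r q"
  using assms ac_class[of w p r] unfolding sep_def by blast

text \<open>An outer point also reaches the class of \<open>y\<close> with its other label, because
  \<open>a \<le> c \<circ> b\<close> and \<open>c \<le> a \<circ> b\<close>.\<close>

lemma splits:
  assumes "a x y \<or> c x y"
  shows "\<exists>p q. E y p \<and> E y q \<and> sep x p q"
  using assms
proof
  assume "a x y"
  moreover then obtain q where "c x q" "b q y" using a_le_cb by blast
  ultimately show ?thesis using b_sym E_refl unfolding sep_def E_def by blast
next
  assume "c x y"
  moreover then obtain p where "a x p" "b p y" using c_le_ab by blast
  ultimately show ?thesis using b_sym E_refl unfolding sep_def E_def by blast
qed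

text \<open>The class separating in the direction opposite to \<open>x\<close> does not change when
  the first point of the pair does.\<close>

lemma two_opposite_separators:
  assumes E: "E p p'" "E p q"
    and x: "sep x p q" "sep x p' q" and u: "sep u q p" and v: "sep v q p'"
  shows "E u v"
proof (rule ccontr)
  assume uv: "\<not> E u v"
  have "c x q" using x(1) by (simp add: sep_def)
  \<comment> \<open>The point \<open>x\<close> cannot separate \<open>q'\<close> from
    \<open>q\<close>; if \<open>u\<close> and \<open>v\<close> lie in different classes, no other
    class can either.\<close>
  then obtain q' where q': "c x q'" "b q' q" using c_le_cb by blast
  have "q' \<noteq> q" "E q' q" using q'(2) b_irrefl by (auto simp: E_def)
  have xq': "sep x p q'" "sep x p' q'" using x q' by (auto simp: sep_def)
  have Eqp: "E q p" "E q p'" "E q' p" "E q' p'" 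
    using E \<open>E q' q\<close> E_sym E_trans by blast+
  have ux: "\<not> E u x" using sep_opposite u x(1) Eqp by blast
  have vx: "\<not> E v x" using sep_opposite v x(2) Eqp by blast
  \<comment> \<open>Otherwise \<open>u\<close> and \<open>v\<close> would both separate
    \<open>q\<close> over \<open>p'\<close>.\<close>
  have "\<not> c u p'"
    using uv u v sep_same by (auto simp: sep_def)
  then have "a u p'"
    using ac_class[of u q p'] u Eqp by (auto simp: sep_def)
  then have "\<not> c u q'"
    using ux xq' sep_same by (auto simp: sep_def)
  then have uq': "sep u q' p"
    using ac_class[of u q q'] u E_sym[OF \<open>E q' q\<close>] by (auto simp: sep_def)
  have "\<not> c v p"
    using uv u v sep_same by (auto simp: sep_def)
  then have "a v p"
    using ac_class[of v q p] v Eqp by (auto simp: sep_def)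
  then have "\<not> c v q'"
    using vx xq' sep_same by (auto simp: sep_def)
  then have vq': "sep v q' p'"
    using ac_class[of v q q'] v E_sym[OF \<open>E q' q\<close>] by (auto simp: sep_def)
  \<comment> \<open>A separator of \<open>q\<close> and \<open>q'\<close> outside the class of
    \<open>x\<close> separates one of them over both \<open>p\<close> and \<open>p'\<close>, so it
    is equivalent to both \<open>u\<close> and \<open>v\<close>.\<close>
  have only_x: "E w x" if w: "sep w r s" and r: "r = q \<and> s = q' \<or> r = q' \<and> s = q" for w r s
  proof (rule ccontr)
    assume "\<not> E w x"
    have Er: "E r p" "E r p'" using r Eqp by auto
    have "\<not> sep w p s" "\<not> sep w p' s"
      using sep_same \<open>\<not> E w x\<close> r x xq' by blast+
    then have "sep w r p" "sep w r p'" using sep_cases[OF w] Er by blast+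
    then have "E w u" "E w v" using sep_same r u v uq' vq' by blast+
    then show False using uv E_sym E_trans by blast
  qed
  obtain w w' where w: "sep w q q'" "sep w' q' q"
    using sep_exists \<open>q' \<noteq> q\<close> \<open>E q' q\<close> E_sym by metis
  then have "E w x" "E w' x" using only_x by blast+
  then show False using sep_opposite[OF E_sym[OF \<open>E q' q\<close>] w] E_sym E_trans by blast
qed

text \<open>A third class, that of \<open>w\<close>, can only split points \<open>r\<close>,
  \<open>s\<close> to which \<open>x\<close> gives equal labels. Comparing them with whichever of
  \<open>p\<close>, \<open>q\<close> gets the other label from \<open>x\<close> puts
  \<open>w\<close> into the class of \<open>x\<close> or of \<open>u\<close>.\<close>

lemma constant_opposite_separators:
  assumes E: "E p q" and x: "sep x p q" and u: "sep u q p"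
    and w: "\<not> E w x" "\<not> E w u" "a w p \<or> c w p"
    and const: "\<And>p' q' u'. E p p' \<Longrightarrow> E p q' \<Longrightarrow> sep x p' q' \<Longrightarrow> sep u' q' p' \<Longrightarrow> E u' u"
  shows False
proof -
  obtain r s where rs: "E p r" "E p s" "sep w r s"
    using splits[OF w(3)] by blast
  have no1: "\<not> (a x r \<and> c x s)" using sep_same rs(3) w(1) by (auto simp: sep_def)
  have no2: "\<not> (c x r \<and> a x s)" using const[of s r w] rs w(2) by (auto simp: sep_def)
  have xrs: "a x r \<or> c x r" "a x s \<or> c x s"
    using ac_class[of x p] x rs by (auto simp: sep_def)
  have w_split: "sep w r t \<or> sep w t s" if "E p t" for t
    using sep_cases[OF rs(3)] that rs(1) E_sym E_trans by blast
  show False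
  proof (cases "a x r")
    case True
    then have "a x s" using xrs no1 by blast
    from w_split[OF E] show False
    proof
      assume "sep w r q"
      then show False using sep_same[of w r q x] w(1) True x by (auto simp: sep_def)
    next
      assume "sep w q s"
      then show False using const[of s q w] rs E w(2) \<open>a x s\<close> x by (auto simp: sep_def)
    qed
  next
    case False
    then have "c x r" "c x s" using xrs no2 by blast+
    from w_split[OF E_refl] show False
    proof
      assume "sep w r p"
      then show False using const[of p r w] rs E_refl w(2) \<open>c x r\<close> x by (auto simp: sep_def)
    next
      assume "sep w p s"
      then show False using sep_same[of w p s x] w(1) \<open>c x s\<close> x by (auto simp: sep_def)
    qed
  qed
qed

text \<open>Exchanging \<open>a\<close> and \<open>c\<close> reverses \<open>sep\<close>, so now the
  second point of the pair varies.\<close>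

lemma two_opposite_separators_dual:
  assumes E: "E p q" "E p q'"
    and x: "sep x p q" "sep x p q'" and u: "sep u q p" and v: "sep v q' p"
  shows "E u v"
proof -
  interpret swap: representation51 c b a by (rule swap)
  have swap_sep: "swap.sep y r s \<longleftrightarrow> sep y s r" for y r s
    by (auto simp: swap.sep_def sep_def)
  show ?thesis
    by (rule swap.two_opposite_separators[of q q' p x, unfolded swap_sep])
      (fact x u v E_sym[OF E(1)] E_trans[OF E_sym[OF E(1)] E(2)])+
qed

lemma no_four_classes:
  assumes "a x y \<or> c x y" "a z y \<or> c z y" "a w y \<or> c w y"
    and "\<not> E x z" "\<not> E x w" "\<not> E z w"
  shows False
proof -
  obtain p q where pq: "E y p" "E y q" "sep x p q"
    using splits[OF assms(1)] by blast
  have E: "E p q" using pq E_sym E_trans by blast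
  have "p \<noteq> q" using sep_neq pq(3) .
  then obtain u where u: "sep u q p" using sep_exists[OF E_sym[OF E]] by blast
  have const: "E u' u"
    if h: "E p p'" "E p q'" "sep x p' q'" "sep u' q' p'" for p' q' u'
  proof -
    have "sep x p' q" using h(3) pq(3) by (simp add: sep_def)
    have Epq: "E p' q" "E p' q'" using h E E_sym E_trans by blast+
    \<comment> \<open>The pair \<open>p'\<close>, \<open>q\<close> links \<open>p\<close>,
      \<open>q\<close> to \<open>p'\<close>, \<open>q'\<close>, changing one point at a
      time.\<close>
    then obtain v where v: "sep v q p'"
      using sep_exists[OF E_sym[OF Epq(1)]] sep_neq[OF \<open>sep x p' q\<close>] by blast
    have "E u v"
      by (rule two_opposite_separators[OF h(1) E pq(3) \<open>sep x p' q\<close> u v])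
    moreover have "E v u'"
      by (rule two_opposite_separators_dual[OF Epq \<open>sep x p' q\<close> h(3) v h(4)])
    ultimately show ?thesis using E_sym E_trans by blast
  qed
  \<comment> \<open>Only two outer classes remain, so \<open>z\<close> and \<open>w\<close>, both
    outside that of \<open>x\<close>, share the class of \<open>u\<close>.\<close>
  have no: "E t x \<or> E t u" if "a t y \<or> c t y" for t
  proof (rule ccontr)
    assume "\<not> (E t x \<or> E t u)"
    then have "\<not> E t x" "\<not> E t u" by blast+
    from constant_opposite_separators[OF E pq(3) u this ac_class[OF that pq(1)]] const
    show False .
  qed
  from no[OF assms(2)] no[OF assms(3)] show False
    using assms(4-6) E_sym E_trans by blast
qed

end

section \<open>Label relations of a given representation\<close>

lemma comp51_singletons: "comp51 {p} {q} = {r. below51 p q r}"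
  by (simp add: comp51_def)

locale represented =
  fixes B :: "'b set" and R
  assumes rep: "ra51.representation B R"
begin

text \<open>Since \<open>R\<close> is only known to respect binary joins, the finiteness of the set
  of atoms enters here.\<close>

lemma R_singletons: "R X = (\<Union>p\<in>X. R {p})"
proof -
  have "(UNIV :: atom51 set) = {At_Id, At_a, At_b, At_c}"
    using atom51.exhaust by blast
  then have "finite (UNIV :: atom51 set)"
    by (metis finite.emptyI finite.insertI)
  then have "finite X" by (rule rev_finite_subset) simp
  have R_insert: "R (insert p Y) = R {p} \<union> R Y" for p Y
  proof -
    have "insert p Y = sup {p} Y" by simp
    then show ?thesis using rep unfolding ra51.representation_def by metis
  qed
  from \<open>finite X\<close> show ?thesis
  proof induction
    case empty
    show ?case using rep unfolding ra51.representation_def by simp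
  next
    case (insert p Y)
    then show ?case using R_insert[of p Y] by blast
  qed
qed

lemma R_disjoint:
  assumes "p \<noteq> q"
  shows "R {p} \<inter> R {q} = {}"
proof -
  have "R {q} \<subseteq> R (- {p})"
    using assms by (subst (2) R_singletons) auto
  also have "\<dots> = R top - R {p}"
    using rep unfolding ra51.representation_def by blast
  finally show ?thesis by blast
qed

lemma R_comp: "R {p} O R {q} = (\<Union>r\<in>{r. below51 p q r}. R {r})"
  using rep comp51_singletons R_singletons[of "comp51 {p} {q}"]
  unfolding ra51.representation_def by metis

lemma R_compE:
  assumes "(x, y) \<in> R {p}" "(y, z) \<in> R {q}"
  shows "\<exists>r. below51 p q r \<and> (x, z) \<in> R {r}"
  using assms R_comp[of p q] by blast

lemma R_witness:
  assumes "(x, z) \<in> R {r}" "below51 p q r"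
  shows "\<exists>y. (x, y) \<in> R {p} \<and> (y, z) \<in> R {q}"
  using assms R_comp[of p q] by blast

lemma R_Id: "(x, y) \<in> R {At_Id} \<longleftrightarrow> x = y \<and> x \<in> B"
  using rep unfolding ra51.representation_def by auto

lemma R_in_B: "(x, y) \<in> R X \<Longrightarrow> x \<in> B"
  using rep unfolding ra51.representation_def by auto

lemma R_sym: "(x, y) \<in> R X \<Longrightarrow> (y, x) \<in> R X"
  using rep unfolding ra51.representation_def conv51_def by auto

sublocale representation51 "\<lambda>x y. (x, y) \<in> R {At_a}" "\<lambda>x y. (x, y) \<in> R {At_b}"
  "\<lambda>x y. (x, y) \<in> R {At_c}"
proof -
  have irrefl: "(x, x) \<notin> R {p}" if "p \<noteq> At_Id" for x p
    using R_disjoint[OF that] R_Id R_in_B by blast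
  have not_both: "\<not> ((x, y) \<in> R {p} \<and> (x, y) \<in> R {q})" if "p \<noteq> q" for x y p q
    using R_disjoint[OF that] by blast
  show "representation51 (\<lambda>x y. (x, y) \<in> R {At_a}) (\<lambda>x y. (x, y) \<in> R {At_b})
    (\<lambda>x y. (x, y) \<in> R {At_c})"
    \<comment> \<open>Three groups of goals follow: symmetry, irreflexivity and disjointness; then
      the composition rules; then the existence of witnesses.\<close>
    apply unfold_locales
                     apply (erule R_sym | (rule irrefl not_both, simp))+
           apply ((drule (1) R_compE, auto simp: ex_atom51 below51_def forbidden51_def R_Id)[1])+
         apply (erule R_witness, simp add: below51_def forbidden51_def)+
    done
qed

end

section \<open>The four networks\<close>

lemma consistent51:
  assumes "f \<in> {f1, f2, f3, f4}"
  shows "ra51.consistent N51 f"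
proof -
  note defs = ra51.consistent_def ra51.network_def N51_def comp51_singletons
    below51_def forbidden51_def doubleton_eq_iff
  have "ra51.consistent N51 f1" by (simp add: defs f1_def)
  moreover have "ra51.consistent N51 f2" by (simp add: defs f2_def)
  moreover have "ra51.consistent N51 f3" by (simp add: defs f3_def)
  moreover have "ra51.consistent N51 f4" by (simp add: defs f4_def)
  ultimately show ?thesis using assms by blast
qed

lemma (in represented) unsatisfiable51:
  assumes "f \<in> {f1, f2, f3, f4}"
  shows "\<not> ra51.satisfiable N51 f B R"
proof
  assume "ra51.satisfiable N51 f B R"
  then obtain s where s: "\<And>i j. i \<in> N51 \<Longrightarrow> j \<in> N51 \<Longrightarrow> (s i, s j) \<in> R (f i j)"
    unfolding ra51.satisfiable_def by blast
  show False
  proof (cases "f = f4")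
    case True
    show False
      by (rule f4_unsat[of "s 2" "s 3" "s 0" "s 1"])
        (use s[of 2 3] s[of 0 1] s[of 0 2] s[of 1 3] s[of 0 3] s[of 1 2] True in
          \<open>simp_all add: N51_def f4_def doubleton_eq_iff\<close>)
  next
    case False
    \<comment> \<open>The label \<open>b\<close> does not occur in \<open>f1\<close>,
      \<open>f2\<close>, \<open>f3\<close>, so the four points lie in four different
      classes.\<close>
    then have ac: "(s i, s j) \<in> R {At_a} \<or> (s i, s j) \<in> R {At_c}"
      if "i \<in> N51" "j \<in> N51" "i \<noteq> j" for i j
      using s[OF that(1,2)] assms that(3) by (auto simp: f1_def f2_def f3_def split: if_splits)
    then have "\<not> E (s i) (s j)" if "i \<in> N51" "j \<in> N51" "i \<noteq> j" for i j
      using not_E that by blast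
    then show False
      using no_four_classes[of "s 0" "s 1" "s 2" "s 3"] ac by (simp add: N51_def)
  qed
qed

theorem lemma4p23:
  shows "(\<forall>f \<in> {f1, f2, f3, f4}. ra51.consistent N51 f) \<and>
    (\<forall>(B :: 'b set) R. ra51.representation B R \<longrightarrow>
       (\<forall>f \<in> {f1, f2, f3, f4}. \<not> ra51.satisfiable N51 f B R))"
  using consistent51 represented.unsatisfiable51 represented.intro by blast

end
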